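(* Let $P$ be a set of $n$ points in $\mathbb{R}$, each belonging to exactly one of the groups $\mathbf{g}_1,\dots,\mathbf{g}_k$, and let $m$ be a number of buckets dividing every $|\mathbf{g}_i|$. Regardless of how the points are distributed and ordered, there exists a cut-based hashmap with $m$ buckets that is $0$-unfair, i.e., in which every bucket contains exactly $|\mathbf{g}_i|/m$ points of $\mathbf{g}_i$ for every $i$, so that $\sum_{j=1}^m(\alpha_{i,j}/|\mathbf{g}_i|)^2=\frac1m$ for every group $i$.
   Context: Let $p_1,\dots,p_n$ be the points of $P$ sorted by value (ties broken arbitrarily). A cut-based hashmap with $m$ buckets is a partition of the sequence $p_1,\dots,p_n$ into contiguous blocks (bins), obtained by placing boundaries between consecutive points, together with an assignment of each bin to one of the $m$ buckets (a bucket may receive several non-consecutive bins). $\alpha_{i,j}$ denotes the number of points of $\mathbf{g}_i$ assigned to bucket $j$; the hashmap is $0$-unfair if $\max_i\sum_j(\alpha_{i,j}/|\mathbf{g}_i|)^2\le \frac1m$. *)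

theory Defs
  imports Complex_Main
begin

text \<open>
  A point is an element of an arbitrary type with a real position \<open>val x\<close>; this allows
  several points to share a value. For a plain set of reals take \<open>val = id\<close>.
  In an ordering of \<open>P\<close> by value, the order among tied points is arbitrary.
\<close>

definition sorted_order :: "('a \<Rightarrow> real) \<Rightarrow> 'a set \<Rightarrow> 'a list \<Rightarrow> bool" where
  "sorted_order val P ps \<longleftrightarrow> set ps = P \<and> distinct ps \<and> sorted (map val ps)"

text \<open>The groups \<open>g 1, \<dots>, g k\<close> are nonempty, so that the ratios
  \<open>\<alpha>\<^sub>i\<^sub>j / |g i|\<close> are meaningful.\<close>

definition grouping :: "'a set \<Rightarrow> nat \<Rightarrow> (nat \<Rightarrow> 'a set) \<Rightarrow> bool" where
  "grouping P k g \<longleftrightarrow>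
     (\<forall>i\<in>{1..k}. g i \<subseteq> P \<and> g i \<noteq> {}) \<and> (\<forall>x\<in>P. \<exists>!i. i \<in> {1..k} \<and> x \<in> g i)"

text \<open>A hashmap is the left-to-right list of its bins, each paired with the bucket in
  \<open>{1..m}\<close> it is assigned to. Cutting \<open>ps\<close> into contiguous blocks means that
  the bins are nonempty and concatenate to \<open>ps\<close>.\<close>

type_synonym 'a hashmap = "('a list \<times> nat) list"

definition cut_based_hashmap :: "nat \<Rightarrow> 'a list \<Rightarrow> 'a hashmap \<Rightarrow> bool" where
  "cut_based_hashmap m ps H \<longleftrightarrow>
     concat (map fst H) = ps \<and> (\<forall>(b, j)\<in>set H. b \<noteq> [] \<and> j \<in> {1..m})"

definition bucket :: "'a hashmap \<Rightarrow> nat \<Rightarrow> 'a set" where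
  "bucket H j = \<Union> {set b | b. (b, j) \<in> set H}"

definition alpha :: "(nat \<Rightarrow> 'a set) \<Rightarrow> 'a hashmap \<Rightarrow> nat \<Rightarrow> nat \<Rightarrow> nat" where
  "alpha g H i j = card (g i \<inter> bucket H j)"

definition collision :: "nat \<Rightarrow> (nat \<Rightarrow> 'a set) \<Rightarrow> 'a hashmap \<Rightarrow> nat \<Rightarrow> real" where
  "collision m g H i = (\<Sum>j = 1..m. (real (alpha g H i j) / real (card (g i)))\<^sup>2)"

definition zero_unfair :: "nat \<Rightarrow> nat \<Rightarrow> (nat \<Rightarrow> 'a set) \<Rightarrow> 'a hashmap \<Rightarrow> bool" where
  "zero_unfair k m g H \<longleftrightarrow> Max (collision m g H ` {1..k}) \<le> 1 / real m"

end

theory Submission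
  imports Defs
begin

text \<open>
  The number of cuts is unrestricted, so every point can form a bin of its own. The bucket of a
  point can then be chosen freely, and dealing the points of each group to the buckets in round
  robin fashion splits every group evenly.
\<close>

text \<open>The numbers concerned are exactly \<open>m * t + r\<close> with \<open>t < q\<close>,
  and \<open>t\<close> is recovered from the value because \<open>r < m\<close> forces
  \<open>m > 0\<close>.\<close>

lemma card_residue_class:
  fixes m q r :: nat
  assumes "r < m"
  shows "card {x. x < m * q \<and> x mod m = r} = q"
proof -
  have "{x. x < m * q \<and> x mod m = r} = (\<lambda>t. m * t + r) ` {..<q}"
  proof (intro equalityI subsetI)
    fix x assume "x \<in> {x. x < m * q \<and> x mod m = r}"
    then have "x = m * (x div m) + r" "x div m < q"
      by (auto simp: less_mult_imp_div_less mult.commute)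
    then show "x \<in> (\<lambda>t. m * t + r) ` {..<q}"
      by blast
  next
    fix x assume "x \<in> (\<lambda>t. m * t + r) ` {..<q}"
    then obtain t where t: "t < q" "x = m * t + r"
      by blast
    have "m * t + r < m * Suc t"
      using assms by simp
    also have "\<dots> \<le> m * q"
      using t(1) by (intro mult_le_mono2) simp
    finally show "x \<in> {x. x < m * q \<and> x mod m = r}"
      using t(2) assms by simp
  qed
  moreover have "inj_on (\<lambda>t. m * t + r) {..<q}"
    using assms by (auto intro: inj_onI)
  ultimately show ?thesis
    by (simp add: card_image)
qed

text \<open>Number the elements of \<open>S\<close> from 0 and deal by index modulo
  \<open>m\<close>: since \<open>m\<close> divides \<open>card S\<close>, the indices fill complete
  rounds. Bounding \<open>f x\<close> for every \<open>x\<close>, not only on \<open>S\<close>,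
  spares membership side conditions later.\<close>

lemma ex_even_distribution:
  fixes m :: nat
  assumes "finite S" "m \<ge> 1" "m dvd card S"
  shows "\<exists>f. (\<forall>x. f x \<in> {1..m}) \<and> (\<forall>j\<in>{1..m}. card {x \<in> S. f x = j} = card S div m)"
proof -
  obtain h where h: "bij_betw h S {0..<card S}"
    using ex_bij_betw_finite_nat[OF assms(1)] by blast
  \<comment> \<open>\<open>Suc\<close> shifts the residues \<open>0..m-1\<close> to the bucket
    numbers \<open>1..m\<close>; hence the \<open>j - 1\<close> below.\<close>
  define f where "f x = Suc (h x mod m)" for x
  have "f x \<in> {1..m}" for x
    using assms(2) by (simp add: f_def Suc_le_eq)
  moreover have "card {x \<in> S. f x = j} = card S div m" if j: "j \<in> {1..m}" for j
  proof -
    have eq: "f x = j \<longleftrightarrow> h x mod m = j - 1" for x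
      using j by (auto simp: f_def)
    \<comment> \<open>Divisibility enters here: \<open>m * (card S div m)\<close> equals
      \<open>card S\<close>.\<close>
    have "h ` S = {y. y < m * (card S div m)}"
      using bij_betw_imp_surj_on[OF h] assms(3) by auto
    moreover have "h ` {x \<in> S. h x mod m = j - 1} = {y \<in> h ` S. y mod m = j - 1}"
      by auto
    ultimately have "h ` {x \<in> S. f x = j} = {y. y < m * (card S div m) \<and> y mod m = j - 1}"
      by (simp add: eq)
    moreover have "inj_on h {x \<in> S. f x = j}"
      by (rule inj_on_subset[OF bij_betw_imp_inj_on[OF h]]) blast
    ultimately have "card {x \<in> S. f x = j} = card {y. y < m * (card S div m) \<and> y mod m = j - 1}"
      by (metis card_image)
    also have "\<dots> = card S div m"
      using j by (intro card_residue_class) auto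
    finally show ?thesis .
  qed
  ultimately show ?thesis
    by blast
qed

text \<open>Each point of \<open>P\<close> lies in exactly one group, so the separate assignments of
  the groups never conflict and glue to a single \<open>F\<close>.\<close>

lemma ex_even_distribution_groups:
  assumes "finite P" "grouping P k g" "m \<ge> 1" "\<forall>i\<in>{1..k}. m dvd card (g i)"
  shows "\<exists>F. (\<forall>x. F x \<in> {1..m}) \<and>
    (\<forall>i\<in>{1..k}. \<forall>j\<in>{1..m}. card {x \<in> g i. F x = j} = card (g i) div m)"
proof -
  have sub: "g i \<subseteq> P" if "i \<in> {1..k}" for i
    using assms(2) that by (simp add: grouping_def)
  have "\<forall>i\<in>{1..k}. \<exists>f. (\<forall>x. f x \<in> {1..m}) \<and>
      (\<forall>j\<in>{1..m}. card {x \<in> g i. f x = j} = card (g i) div m)"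
    using assms sub by (intro ballI ex_even_distribution) (auto intro: finite_subset)
  then obtain f where f: "\<And>i x. i \<in> {1..k} \<Longrightarrow> f i x \<in> {1..m}"
    "\<And>i j. i \<in> {1..k} \<Longrightarrow> j \<in> {1..m} \<Longrightarrow> card {x \<in> g i. f i x = j} = card (g i) div m"
    by metis
  define idx where "idx x = (THE i. i \<in> {1..k} \<and> x \<in> g i)" for x
  \<comment> \<open>Outside \<open>P\<close> the index \<open>idx x\<close> is meaningless; the
    default 1 is a legal bucket because \<open>m \<ge> 1\<close>.\<close>
  define F where "F x = (if x \<in> P then f (idx x) x else 1)" for x
  have uniq: "\<exists>!i. i \<in> {1..k} \<and> x \<in> g i" if "x \<in> P" for x
    using assms(2) that by (simp add: grouping_def)
  have "F x \<in> {1..m}" for x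
    using f(1)[of "idx x" x] theI'[OF uniq, of x] assms(3) by (auto simp: F_def idx_def)
  moreover have "card {x \<in> g i. F x = j} = card (g i) div m"
    if ij: "i \<in> {1..k}" "j \<in> {1..m}" for i j
  proof -
    have "F x = f i x" if "x \<in> g i" for x
    proof -
      have "x \<in> P"
        using sub[OF ij(1)] that by blast
      moreover from this have "idx x = i"
        unfolding idx_def using ij(1) that by (intro the1_equality uniq) auto
      ultimately show ?thesis
        by (simp add: F_def)
    qed
    then have "{x \<in> g i. F x = j} = {x \<in> g i. f i x = j}"
      by auto
    then show ?thesis
      using f(2)[OF ij] by simp
  qed
  ultimately show ?thesis
    by blast
qed

theorem theorem4p1:
  fixes P :: "'a set" and val :: "'a \<Rightarrow> real" and g :: "nat \<Rightarrow> 'a set"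
    and n k m :: nat and ps :: "'a list"
  assumes "finite P" and "card P = n"
    and "k \<ge> 1" and "grouping P k g"
    and "m \<ge> 1" and "\<forall>i\<in>{1..k}. m dvd card (g i)"
    and "sorted_order val P ps"
  shows "\<exists>H. cut_based_hashmap m ps H
           \<and> zero_unfair k m g H
           \<and> (\<forall>i\<in>{1..k}. \<forall>j\<in>{1..m}. real (alpha g H i j) = real (card (g i)) / real m)
           \<and> (\<forall>i\<in>{1..k}. (\<Sum>j = 1..m. (real (alpha g H i j) / real (card (g i)))\<^sup>2) = 1 / real m)"
proof -
  obtain F where F: "\<And>x. F x \<in> {1..m}"
    "\<And>i j. i \<in> {1..k} \<Longrightarrow> j \<in> {1..m} \<Longrightarrow> card {x \<in> g i. F x = j} = card (g i) div m"
    using ex_even_distribution_groups[OF assms(1,4,5,6)] by blast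
  define H where "H = map (\<lambda>x. ([x], F x)) ps"
  have ps: "set ps = P"
    using assms(7) by (simp add: sorted_order_def)
  have g: "g i \<subseteq> P" "g i \<noteq> {}" if "i \<in> {1..k}" for i
    using assms(4) that by (simp_all add: grouping_def)
  have cut: "cut_based_hashmap m ps H"
    using F(1) by (auto simp: cut_based_hashmap_def H_def comp_def)
  have bucket: "bucket H j = {x \<in> P. F x = j}" for j
  proof -
    \<comment> \<open>Written as an image of singleton lists, the bins of bucket \<open>j\<close>
      have a union that simplifies to the fibre of \<open>F\<close> over \<open>j\<close>.\<close>
    have "(b, j) \<in> set H \<longleftrightarrow> b \<in> (\<lambda>x. [x]) ` {x \<in> P. F x = j}" for b
      by (auto simp: H_def ps)
    then show ?thesis
      by (simp add: bucket_def setcompr_eq_image image_image)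
  qed
  have alpha: "real (alpha g H i j) = real (card (g i)) / real m"
    if ij: "i \<in> {1..k}" "j \<in> {1..m}" for i j
  proof -
    have "g i \<inter> bucket H j = {x \<in> g i. F x = j}"
      using g(1)[OF ij(1)] by (auto simp: bucket)
    \<comment> \<open>As \<open>m\<close> divides \<open>card (g i)\<close>, the \<open>div\<close>
      on naturals is the exact real quotient.\<close>
    then show ?thesis
      using F(2)[OF ij] assms(6) ij(1) by (simp add: alpha_def real_of_nat_div)
  qed
  have sum: "(\<Sum>j = 1..m. (real (alpha g H i j) / real (card (g i)))\<^sup>2) = 1 / real m"
    if i: "i \<in> {1..k}" for i
  proof -
    \<comment> \<open>Needed to cancel \<open>card (g i)\<close>, which leaves the ratio
      \<open>1 / real m\<close> in each of the \<open>m\<close> terms.\<close>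
    have "card (g i) \<noteq> 0"
      using g[OF i] assms(1) by (auto dest: finite_subset)
    then have "(\<Sum>j = 1..m. (real (alpha g H i j) / real (card (g i)))\<^sup>2)
        = (\<Sum>j = 1..m. (1 / real m)\<^sup>2)"
      using alpha[OF i] by (intro sum.cong) simp_all
    also have "\<dots> = 1 / real m"
      by (simp add: power2_eq_square)
    finally show ?thesis .
  qed
  \<comment> \<open>All collision values coincide, and \<open>k \<ge> 1\<close> makes their set the
    singleton of \<open>1 / real m\<close>, so \<open>Max\<close> is that value.\<close>
  have "zero_unfair k m g H"
    using sum assms(3) by (simp add: zero_unfair_def collision_def)
  with cut alpha sum show ?thesis
    by blast
qed

end
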